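(* Let $n\ge 3$, $b<-2$, and let $\widetilde b\in\mathbb{R}$ be such that $\widetilde T_n$ is nonsingular. Put $\beta=\widetilde b-b$. Then for every $1\le i\le n$ the sum of the entries of the $i$-th row of $\widetilde T_n^{-1}$ equals $$\frac{1}{b-2}-\frac{\beta+1}{b-2}\cdot\frac{\gamma_{n+1-i}+\gamma_i}{\gamma_{n+1}+\beta(\gamma_1+\gamma_n)}.$$
   Context: For an integer $n\ge 3$ and real $b,\widetilde b$, $\widetilde T_n$ is the $n\times n$ real symmetric tridiagonal matrix with diagonal entries $(\widetilde b,b,b,\dots,b,\widetilde b)$ (first and last equal to $\widetilde b$, all others equal to $b$) and all sub- and superdiagonal entries equal to $-1$. For $b<-2$ put $r_1=\tfrac12(b+\sqrt{b^2-4})$, $r_2=\tfrac12(b-\sqrt{b^2-4})$ and $\gamma_k=r_1^k-r_2^k$ for integers $k\ge 0$. *)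

theory Defs
  imports Complex_Main "Jordan_Normal_Form.Matrix" "Jordan_Normal_Form.Gauss_Jordan_Elimination"
begin

text \<open>Rows and columns are numbered from 0, so row \<open>i\<close> of the usual numbering is
  row \<open>i - 1\<close> here, and the two corner entries sit at indices 0 and \<open>n - 1\<close>.\<close>

definition T_tilde :: "nat \<Rightarrow> real \<Rightarrow> real \<Rightarrow> real mat" where
  "T_tilde n b bt = mat n n (\<lambda>(i, j).
     if i = j then (if i = 0 \<or> i = n - 1 then bt else b)
     else if i = j + 1 \<or> j = i + 1 then -1
     else 0)"

definition r1 :: "real \<Rightarrow> real" where
  "r1 b = (b + sqrt (b\<^sup>2 - 4)) / 2"

definition r2 :: "real \<Rightarrow> real" where
  "r2 b = (b - sqrt (b\<^sup>2 - 4)) / 2"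

definition gam :: "real \<Rightarrow> nat \<Rightarrow> real" where
  "gam b k = r1 b ^ k - r2 b ^ k"

text \<open>\<open>mat_inverse\<close> is option-valued; by the following fact, \<open>the (mat_inverse A)\<close> is
  the two-sided inverse of any invertible \<open>A\<close>.\<close>

lemma the_mat_inverse:
  fixes A :: "'a :: field mat"
  assumes A: "A \<in> carrier_mat n n" and inv: "invertible_mat A"
  shows "the (mat_inverse A) \<in> carrier_mat n n"
    and "A * the (mat_inverse A) = 1\<^sub>m n"
    and "the (mat_inverse A) * A = 1\<^sub>m n"
proof -
  from inv obtain B where B: "A * B = 1\<^sub>m (dim_row A)" "B * A = 1\<^sub>m (dim_row B)"
    unfolding invertible_mat_def inverts_mat_def by auto
  have "dim_col B = n" using arg_cong[OF B(1), of dim_col] A by simp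
  moreover have "dim_row B = n" using arg_cong[OF B(2), of dim_col] A by simp
  ultimately have "A \<in> Units (ring_mat TYPE('a) n n)"
    using A B unfolding Units_def ring_mat_def by auto
  with mat_inverse(1)[OF A, where b = n] obtain C where C: "mat_inverse A = Some C"
    by (cases "mat_inverse A") auto
  from mat_inverse(2)[OF A C] C
  show "the (mat_inverse A) \<in> carrier_mat n n"
    "A * the (mat_inverse A) = 1\<^sub>m n" "the (mat_inverse A) * A = 1\<^sub>m n" by auto
qed

end

theory Submission
  imports Defs
begin

text \<open>Extending a vector by \<open>x\<^sub>0\<close> and \<open>x\<^sub>n\<^sub>+\<^sub>1\<close> turns every row of \<open>T_tilde\<close> into the same
  second-order recurrence, the two corners becoming the boundary conditions
  \<open>x\<^sub>0 + \<beta> x\<^sub>1 = 0\<close> and \<open>x\<^sub>n\<^sub>+\<^sub>1 + \<beta> x\<^sub>n = 0\<close>. The constant \<open>1 / (b - 2)\<close> solves the recurrence with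
  right-hand side 1, and the symmetric sequence \<open>\<gamma>\<^sub>n\<^sub>+\<^sub>1\<^sub>-\<^sub>i + \<gamma>\<^sub>i\<close> solves the homogeneous one; a suitable
  combination of the two meets the boundary conditions. If the denominator
  \<open>\<gamma>\<^sub>n\<^sub>+\<^sub>1 + \<beta> (\<gamma>\<^sub>1 + \<gamma>\<^sub>n)\<close> vanished, the symmetric sequence itself would be a kernel vector.\<close>

lemma r1_add_r2: "r1 b + r2 b = b"
  by (simp add: r1_def r2_def field_simps)

lemma r1_mult_r2:
  assumes "b < -2"
  shows "r1 b * r2 b = 1"
proof -
  have "4 \<le> b\<^sup>2" using assms power_mono[of 2 "-b" 2] by simp
  then have "sqrt (b\<^sup>2 - 4) * sqrt (b\<^sup>2 - 4) = b\<^sup>2 - 4" by simp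
  then show ?thesis by (simp add: r1_def r2_def field_simps power2_eq_square)
qed

lemma gam_0: "gam b 0 = 0"
  by (simp add: gam_def)

text \<open>By Vieta, \<open>r1 b\<close> and \<open>r2 b\<close> are the roots of x^2 - b x + 1, so
  the powers of each satisfy this recurrence, and hence so does their difference.\<close>

lemma gam_Suc_Suc:
  assumes "b < -2"
  shows "gam b (Suc (Suc k)) = b * gam b (Suc k) - gam b k"
proof -
  have root: "r ^ Suc (Suc k) = b * r ^ Suc k - r ^ k" if "r * r = b * r - 1" for r :: real
  proof -
    have "r ^ Suc (Suc k) = (r * r) * r ^ k" by simp
    also have "\<dots> = (b * r - 1) * r ^ k" by (simp only: that)
    finally show ?thesis by (simp add: algebra_simps)
  qed
  have "r1 b * r1 b = (r1 b + r2 b) * r1 b - r1 b * r2 b"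
    "r2 b * r2 b = (r1 b + r2 b) * r2 b - r1 b * r2 b"
    by (simp_all only: ring_distribs mult.commute add_diff_cancel_left' add_diff_cancel_right')
  then have "r1 b * r1 b = b * r1 b - 1" "r2 b * r2 b = b * r2 b - 1"
    by (simp_all only: r1_add_r2 r1_mult_r2[OF assms])
  from root[OF this(1)] root[OF this(2)] show ?thesis
    unfolding gam_def right_diff_distrib by linarith
qed

text \<open>For even \<open>k\<close>, equal powers only give equal absolute values. The positive
  square root excludes \<open>r1 b = r2 b\<close>, and the nonzero sum \<open>b\<close> excludes
  \<open>r1 b = - r2 b\<close>.\<close>

lemma gam_neq_0:
  assumes "b < -2" and "0 < k"
  shows "gam b k \<noteq> 0"
proof
  assume "gam b k = 0"
  then have "\<bar>r1 b\<bar> ^ k = \<bar>r2 b\<bar> ^ k" by (simp add: gam_def power_abs[symmetric])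
  then have "\<bar>r1 b\<bar> = \<bar>r2 b\<bar>"
    using assms(2) by (simp add: power_eq_iff_eq_base)
  moreover have "0 < sqrt (b\<^sup>2 - 4)"
    using assms(1) power_strict_mono[of 2 "-b" 2] by simp
  moreover have "r1 b - r2 b = sqrt (b\<^sup>2 - 4)" by (simp add: r1_def r2_def field_simps)
  ultimately show False using assms(1) r1_add_r2[of b] by linarith
qed

lemma T_tilde_carrier: "T_tilde n b bt \<in> carrier_mat n n"
  by (simp add: T_tilde_def)

lemma T_tilde_mult_vec:
  assumes n: "2 \<le> n"
    and rec: "\<And>k. k < n \<Longrightarrow> b * f (k + 1) - f k - f (k + 2) = c"
    and left: "f 0 + (bt - b) * f 1 = 0"
    and right: "f (n + 1) + (bt - b) * f n = 0"
  shows "T_tilde n b bt *\<^sub>v vec n (\<lambda>i. f (i + 1)) = vec n (\<lambda>_. c)"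
proof (rule eq_vecI)
  fix i assume "i < dim_vec (vec n (\<lambda>_. c))"
  then have i: "i < n" by simp
  let ?d = "if i = 0 \<or> i = n - 1 then bt else b"
  have "(T_tilde n b bt *\<^sub>v vec n (\<lambda>i. f (i + 1))) $ i
      = (\<Sum>j = 0..<n. T_tilde n b bt $$ (i, j) * f (j + 1))"
    using i by (simp add: T_tilde_def scalar_prod_def)
  \<comment> \<open>The row is split into its three diagonals. At \<open>i = 0\<close> the truncated
    \<open>i - 1\<close> is 0 again and would hit the diagonal, hence the guard
    \<open>0 < i\<close>; at \<open>i = n - 1\<close> the index \<open>i + 1\<close> already lies
    outside the sum.\<close>
  also have "\<dots> = (\<Sum>j = 0..<n. (if j = i then ?d * f (j + 1) else 0)
      - (if j = i - 1 then (if 0 < i then f (j + 1) else 0) else 0)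
      - (if j = i + 1 then f (j + 1) else 0))"
    using i by (intro sum.cong) (auto simp: T_tilde_def)
  also have "\<dots> = ?d * f (i + 1) - (if 0 < i then f i else 0)
      - (if i + 1 < n then f (i + 2) else 0)"
    using i by (simp add: sum_subtractf)
  also have "\<dots> = c"
  proof -
    have last: "i + 2 = n + 1" "i + 1 = n" if "i = n - 1" using that i by simp_all
    consider "i = 0" | "i = n - 1" "0 < i" | "0 < i" "i < n - 1" using i by linarith
    then show ?thesis
    proof cases
      case 1
      with n rec[of 0] left show ?thesis by (simp add: algebra_simps)
    next
      case 2
      with rec[OF i] right n show ?thesis
        unfolding last[OF 2(1)] by (simp add: algebra_simps)
    next
      case 3
      then have "i + 1 < n" by simp
      with 3 rec[OF i] show ?thesis by simp
    qed
  qed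
  finally show "(T_tilde n b bt *\<^sub>v vec n (\<lambda>i. f (i + 1))) $ i = vec n (\<lambda>_. c) $ i"
    using i by simp
qed (simp add: T_tilde_def)

text \<open>The recurrence reads the same backwards, so the reflected sequence satisfies it too. The
  bound \<open>k < n\<close> keeps the natural subtractions from truncating.\<close>

lemma symmetric_gam_recurrence:
  assumes "b < -2" and "k < n"
  shows "b * (gam b (n + 1 - (k + 1)) + gam b (k + 1)) - (gam b (n + 1 - k) + gam b k)
    - (gam b (n + 1 - (k + 2)) + gam b (k + 2)) = 0"
proof -
  have "n + 1 - k = Suc (Suc (n - k - 1))" "n + 1 - (k + 1) = Suc (n - k - 1)"
    "n + 1 - (k + 2) = n - k - 1"
    using assms(2) by simp_all
  then show ?thesis
    using gam_Suc_Suc[OF assms(1), of k] gam_Suc_Suc[OF assms(1), of "n - k - 1"]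
    by (simp add: algebra_simps)
qed

lemma mult_mat_vec_the_mat_inverse:
  fixes A :: "'a :: field mat"
  assumes "A \<in> carrier_mat n n" and "invertible_mat A" and "x \<in> carrier_vec n"
  shows "the (mat_inverse A) *\<^sub>v (A *\<^sub>v x) = x"
  using the_mat_inverse[OF assms(1,2)] assms(1,3)
  by (simp flip: assoc_mult_mat_vec)

theorem theorem4p3:
  fixes n :: nat and b bt \<beta> :: real
  assumes "n \<ge> 3" and "b < -2"
    and "invertible_mat (T_tilde n b bt)"
    and "\<beta> = bt - b"
  shows "\<forall>i. 1 \<le> i \<and> i \<le> n \<longrightarrow>
    (\<Sum>j<n. the (mat_inverse (T_tilde n b bt)) $$ (i - 1, j)) =
      1 / (b - 2) - (\<beta> + 1) / (b - 2) *
        ((gam b (n + 1 - i) + gam b i) / (gam b (n + 1) + \<beta> * (gam b 1 + gam b n)))"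
proof (intro allI impI)
  fix i assume i: "1 \<le> i \<and> i \<le> n"
  let ?T = "T_tilde n b bt"
  let ?M = "the (mat_inverse ?T)"
  define v where "v k = gam b (n + 1 - k) + gam b k" for k
  define D where "D = gam b (n + 1) + \<beta> * (gam b 1 + gam b n)"
  \<comment> \<open>At either end the constant sequence contributes
    \<open>(\<beta> + 1) / (b - 2)\<close> and \<open>v\<close> contributes \<open>D\<close>; this
    \<open>K\<close> makes the two cancel.\<close>
  define K where "K = (\<beta> + 1) / (b - 2) / D"
  define f where "f k = 1 / (b - 2) - K * v k" for k
  have n: "2 \<le> n" using assms(1) by simp
  have v_rec: "b * v (k + 1) - v k - v (k + 2) = 0" if "k < n" for k
    using symmetric_gam_recurrence[OF assms(2) that] unfolding v_def .
  \<comment> \<open>Both ends give the same value because \<open>v\<close> is invariant under k -> n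
    + 1 - k.\<close>
  have v_ends: "v 0 + \<beta> * v 1 = D" "v (n + 1) + \<beta> * v n = D"
    by (simp_all add: v_def D_def gam_0)
  have inverse_mult: "?M *\<^sub>v (?T *\<^sub>v x) = x" if "x \<in> carrier_vec n" for x
    using mult_mat_vec_the_mat_inverse[OF T_tilde_carrier assms(3) that] .
  have M: "?M \<in> carrier_mat n n"
    using the_mat_inverse(1)[OF T_tilde_carrier assms(3)] .
  have D: "D \<noteq> 0"
  proof
    assume "D = 0"
    with v_rec v_ends assms(4) have "?T *\<^sub>v vec n (\<lambda>i. v (i + 1)) = vec n (\<lambda>_. 0)"
      by (intro T_tilde_mult_vec[OF n]) auto
    then have "?M *\<^sub>v 0\<^sub>v n = vec n (\<lambda>i. v (i + 1))"
      using inverse_mult[of "vec n (\<lambda>i. v (i + 1))"] by (simp add: zero_vec_def)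
    moreover have "?M *\<^sub>v 0\<^sub>v n = 0\<^sub>v n" using M by (intro eq_vecI) auto
    ultimately have "vec n (\<lambda>i. v (i + 1)) $ 0 = 0\<^sub>v n $ 0" by simp
    \<comment> \<open>The first entry of the kernel vector suffices: with \<open>v 1 = 0\<close>,
      the left boundary condition forces \<open>v 0\<close>, which is \<open>gam b (n + 1)\<close>,
      to vanish.\<close>
    then have "v 1 = 0" using n by simp
    with v_ends(1) \<open>D = 0\<close> have "gam b (n + 1) = 0" by (simp add: v_def gam_0)
    with gam_neq_0[OF assms(2)] show False by simp
  qed
  have f_ends: "f 0 + \<beta> * f 1 = 0" "f (n + 1) + \<beta> * f n = 0"
  proof -
    have "f k + \<beta> * f l = 0" if "v k + \<beta> * v l = D" for k l
    proof -
      have "f k + \<beta> * f l = (\<beta> + 1) / (b - 2) - K * (v k + \<beta> * v l)"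
        by (simp add: f_def algebra_simps add_divide_distrib)
      with that D show ?thesis by (simp add: K_def)
    qed
    with v_ends show "f 0 + \<beta> * f 1 = 0" "f (n + 1) + \<beta> * f n = 0" by blast+
  qed
  have f_rec: "b * f (k + 1) - f k - f (k + 2) = 1" if "k < n" for k
  proof -
    have "b * (c - K * x) - (c - K * y) - (c - K * z) = (b - 2) * c - K * (b * x - y - z)"
      for c x y z :: real by (simp add: algebra_simps)
    then have "b * f (k + 1) - f k - f (k + 2)
        = (b - 2) * (1 / (b - 2)) - K * (b * v (k + 1) - v k - v (k + 2))"
      unfolding f_def .
    with v_rec[OF that] assms(2) show ?thesis by simp
  qed
  have "?T *\<^sub>v vec n (\<lambda>i. f (i + 1)) = vec n (\<lambda>_. 1)"
    using f_rec f_ends assms(4) by (intro T_tilde_mult_vec[OF n]) auto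
  then have "?M *\<^sub>v vec n (\<lambda>_. 1) = vec n (\<lambda>i. f (i + 1))"
    using inverse_mult[of "vec n (\<lambda>i. f (i + 1))"] by simp
  \<comment> \<open>Since \<open>1 \<le> i\<close>, the 0-based row index \<open>i - 1\<close> and
    the shift \<open>f (i + 1)\<close> cancel. Multiplying by the all-ones vector gives the row
    sums.\<close>
  then have "(?M *\<^sub>v vec n (\<lambda>_. 1)) $ (i - 1) = f i" using i by (cases i) simp_all
  moreover have "(?M *\<^sub>v vec n (\<lambda>_. 1)) $ (i - 1) = (\<Sum>j<n. ?M $$ (i - 1, j))"
    using M i by (auto simp: scalar_prod_def lessThan_atLeast0)
  ultimately show "(\<Sum>j<n. ?M $$ (i - 1, j)) = 1 / (b - 2) - (\<beta> + 1) / (b - 2) *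
        ((gam b (n + 1 - i) + gam b i) / (gam b (n + 1) + \<beta> * (gam b 1 + gam b n)))"
    by (simp add: f_def K_def v_def D_def)
qed

end
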